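(* Consider the linear advection system $\partial_t\mathbf U+\nabla\cdot\mathbf F(\mathbf U)=\mathbf 0$, $\mathbf F(\mathbf U)=\mathbf U\otimes\mathbf a$, $\mathbf U\in\mathbb R^m$, with constant $\mathbf a=(a_x,a_y)\in\mathbb R^2$, solved on a fixed quadrilateral mesh $\{I_{i,j}\}$ by the semi-discrete finite-volume scheme with 2-exact reconstruction and the SSPRK3 method described in the context. Let $\mathbf p(x,y)=\sum_{s+r\le2}\mathbf c_{s,r}x^sy^r$ with $\mathbf c_{s,r}\in\mathbb R^m$, and suppose that at time $t^n$, for all $i,j$, $$\overline{\mathbf U}^n_{i,j}=\frac1{|I_{i,j}|}\int_{I_{i,j}}\mathbf p(x,y)\,\mathrm dx\,\mathrm dy=\frac1{\mathcal M_{0,0,i,j}}\sum_{s+r\le2}\mathbf c_{s,r}\,\mathcal M_{s,r,i,j}.$$ Then at time $t^{n+1}=t^n+\Delta t$, for all $i,j$, $$\overline{\mathbf U}^{n+1}_{i,j}=\frac1{\mathcal M_{0,0,i,j}}\sum_{s+r\le2}\mathbf c_{s,r}\left[\sum_{k=0}^s\sum_{\ell=0}^r\binom sk\binom r\ell(-a_x\Delta t)^{s-k}(-a_y\Delta t)^{r-\ell}\mathcal M_{k,\ell,i,j}\right],$$ which coincides with the cell average over $I_{i,j}$ of the exact solution $\mathbf p(x-a_x\Delta t,\,y-a_y\Delta t)$.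
   Context: Mesh. $\{I_{i,j}\}_{1\le i\le N_x,1\le j\le N_y}$ is a fixed, logically rectangular, conforming mesh of nondegenerate convex quadrilaterals with counterclockwise vertices $A,B,C,D$ (neighbouring cells share a full edge). Edges $l^1_{i,j}=AB$, $l^2_{i,j}=BC$, $l^3_{i,j}=CD$, $l^4_{i,j}=DA$ have lengths $|l^k_{i,j}|$ and outward unit normals $\mathbf n_k$. Three-point Gauss--Lobatto points on edge $k$: $\mathbf x_{k,g}$, $g=1,2,3$ (first endpoint, midpoint, second endpoint), with weights $\omega_1=\omega_3=\frac16$, $\omega_2=\frac23$. Geometric moments: $\mathcal M_{s,r,i,j}=\int_{I_{i,j}}x^sy^r\,\mathrm dx\,\mathrm dy$ (so $\mathcal M_{0,0,i,j}=|I_{i,j}|$). Reconstruction. Given cell averages $\overline{\mathbf U}_{i,j}\in\mathbb R^m$, the reconstruction assigns to each cell a function $\mathbf U_h:\mathbb R^2\to\mathbb R^m$ depending on the averages on a stencil of the cell. It is assumed 2-exact: whenever the averages on the stencil of a target cell satisfy $\overline{\mathbf U}_{i,j}=\mathcal M_{0,0,i,j}^{-1}\sum_{s+r\le2}\mathbf d_{s,r}\mathcal M_{s,r,i,j}$ for some $\mathbf d_{s,r}\in\mathbb R^m$, then $\mathbf U_h(x,y)=\sum_{s+r\le2}\mathbf d_{s,r}x^sy^r$ at every $(x,y)$. $\mathbf U^{\mathrm{int}}_{k,g},\mathbf U^{\mathrm{ext}}_{k,g}$ are the values at $\mathbf x_{k,g}$ of the reconstructions in the cell itself and in its neighbour across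 edge $k$. On boundary edges the exterior state is consistent: whenever there is a single polynomial $\mathbf q(x,y)=\sum_{s+r\le2}\mathbf d_{s,r}x^sy^r$, $\mathbf d_{s,r}\in\mathbb R^m$, such that $\overline{\mathbf U}_{i,j}=\mathcal M_{0,0,i,j}^{-1}\sum_{s+r\le2}\mathbf d_{s,r}\mathcal M_{s,r,i,j}$ in all cells, $\mathbf U^{\mathrm{ext}}_{k,g}=\mathbf q(\mathbf x_{k,g})$. Semi-discrete scheme: $$\frac{\mathrm d\overline{\mathbf U}_{i,j}}{\mathrm dt}=\mathcal L_{i,j}(\overline{\mathbf U}):=-\frac1{\mathcal M_{0,0,i,j}}\sum_{k=1}^4|l^k_{i,j}|\sum_{g=1}^3\omega_g\,\tfrac12\bigl[\mathbf F(\mathbf U^{\mathrm{int}}_{k,g})\cdot\mathbf n_k+\mathbf F(\mathbf U^{\mathrm{ext}}_{k,g})\cdot\mathbf n_k-\tilde a^{\max}_{i,j,k}(\mathbf U^{\mathrm{ext}}_{k,g}-\mathbf U^{\mathrm{int}}_{k,g})\bigr],$$ where $\tilde a^{\max}_{i,j,k}$ is the maximum along the edge of the spectral radius of $\partial(\mathbf F(\mathbf U)\cdot\mathbf n_k)/\partial\mathbf U$ (here $|\mathbf a\cdot\mathbf n_k|$). SSPRK3: $\overline{\mathbf U}^{(1)}=\overline{\mathbf U}^n+\Delta t\,\mathcal L(\overline{\mathbf U}^n)$; $\overline{\mathbf U}^{(2)}=\frac34\overline{\mathbf U}^n+\frac14(\overline{\mathbf U}^{(1)}+\Delta t\,\mathcal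 L(\overline{\mathbf U}^{(1)}))$; $\overline{\mathbf U}^{n+1}=\frac13\overline{\mathbf U}^n+\frac23(\overline{\mathbf U}^{(2)}+\Delta t\,\mathcal L(\overline{\mathbf U}^{(2)}))$. *)

theory Defs
  imports "HOL-Analysis.Analysis"
begin

section \<open>Mesh\<close>

type_synonym plane = "real \<times> real"
type_synonym cell = "nat \<times> nat"
type_synonym nodes = "nat \<Rightarrow> nat \<Rightarrow> plane"

definition cells :: "nat \<Rightarrow> nat \<Rightarrow> cell set" where
  "cells Nx Ny = {1..Nx} \<times> {1..Ny}"

text \<open>
  The nodes \<open>P i j\<close>, \<open>0 \<le> i \<le> Nx\<close>, \<open>0 \<le> j \<le> Ny\<close>, are the vertices of the mesh. Adjacent cells
  use the same two nodes, hence share a full edge. Vertices 1, 2, 3, 4 of a cell are \<open>A\<close>, \<open>B\<close>,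
  \<open>C\<close>, \<open>D\<close>; the index is read modulo 4, so that edge \<open>k\<close> runs from vertex \<open>k\<close> to vertex \<open>k + 1\<close>.
\<close>

definition vertex :: "nodes \<Rightarrow> cell \<Rightarrow> nat \<Rightarrow> plane" where
  "vertex P = (\<lambda>(i, j) k.
     if k mod 4 = 1 then P (i - 1) (j - 1)
     else if k mod 4 = 2 then P i (j - 1)
     else if k mod 4 = 3 then P i j
     else P (i - 1) j)"

definition region :: "nodes \<Rightarrow> cell \<Rightarrow> plane set" where
  "region P c = convex hull (vertex P c ` {1..4})"

definition neighbour :: "cell \<Rightarrow> nat \<Rightarrow> cell" where
  "neighbour = (\<lambda>(i, j) k.
     if k = 1 then (i, j - 1)
     else if k = 2 then (i + 1, j)
     else if k = 3 then (i, j + 1)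
     else (i - 1, j))"

definition cross2 :: "plane \<Rightarrow> plane \<Rightarrow> real" where
  "cross2 u v = fst u * snd v - snd u * fst v"

text \<open>
  A strict left turn at each of the four vertices means precisely that they are the vertices, in
  counterclockwise order, of a nondegenerate convex quadrilateral. The second clause says that the
  cells do not overlap and meet only along common edges or vertices.
\<close>

definition quad_mesh :: "nat \<Rightarrow> nat \<Rightarrow> nodes \<Rightarrow> bool" where
  "quad_mesh Nx Ny P \<longleftrightarrow>
     (\<forall>c \<in> cells Nx Ny. \<forall>k \<in> {1..4}.
        0 < cross2 (vertex P c (k + 1) - vertex P c k) (vertex P c (k + 2) - vertex P c (k + 1))) \<and>
     (\<forall>c \<in> cells Nx Ny. \<forall>c' \<in> cells Nx Ny. c \<noteq> c' \<longrightarrow>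
        interior (region P c) \<inter> interior (region P c') = {} \<and>
        (region P c \<inter> region P c') face_of region P c)"

definition edge_length :: "nodes \<Rightarrow> cell \<Rightarrow> nat \<Rightarrow> real" where
  "edge_length P c k = dist (vertex P c k) (vertex P c (k + 1))"

text \<open>The edge vector rotated clockwise by a right angle points out of a counterclockwise cell.\<close>

definition outward_normal :: "nodes \<Rightarrow> cell \<Rightarrow> nat \<Rightarrow> plane" where
  "outward_normal P c k =
     (let e = vertex P c (k + 1) - vertex P c k in (1 / norm e) *\<^sub>R (snd e, - fst e))"

definition lobatto_point :: "nodes \<Rightarrow> cell \<Rightarrow> nat \<Rightarrow> nat \<Rightarrow> plane" where
  "lobatto_point P c k g =
     (if g = 1 then vertex P c k
      else if g = 2 then midpoint (vertex P c k) (vertex P c (k + 1))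
      else vertex P c (k + 1))"

definition lobatto_weight :: "nat \<Rightarrow> real" where
  "lobatto_weight g = (if g = 2 then 2 / 3 else 1 / 6)"


section \<open>Moments, averages and quadratic polynomials\<close>

definition moment :: "plane set \<Rightarrow> nat \<Rightarrow> nat \<Rightarrow> real" where
  "moment K s r = (LINT z:K|lborel. fst z ^ s * snd z ^ r)"

definition cell_average :: "plane set \<Rightarrow> (plane \<Rightarrow> real ^ 'm) \<Rightarrow> real ^ 'm" where
  "cell_average K f = (1 / measure lborel K) *\<^sub>R (LINT z:K|lborel. f z)"

definition quad_poly :: "(nat \<Rightarrow> nat \<Rightarrow> real ^ 'm) \<Rightarrow> plane \<Rightarrow> real ^ 'm" where
  "quad_poly d = (\<lambda>(x, y). \<Sum>s\<le>2. \<Sum>r\<le>2 - s. (x ^ s * y ^ r) *\<^sub>R d s r)"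

definition moment_average :: "plane set \<Rightarrow> (nat \<Rightarrow> nat \<Rightarrow> real ^ 'm) \<Rightarrow> real ^ 'm" where
  "moment_average K d = (1 / moment K 0 0) *\<^sub>R (\<Sum>s\<le>2. \<Sum>r\<le>2 - s. moment K s r *\<^sub>R d s r)"


section \<open>Reconstruction and exterior states\<close>

type_synonym 'm averages = "cell \<Rightarrow> real ^ 'm"

text \<open>\<open>R U c\<close> is the function reconstructed in cell \<open>c\<close> from the averages \<open>U\<close>.\<close>

type_synonym 'm reconstruction = "'m averages \<Rightarrow> cell \<Rightarrow> plane \<Rightarrow> real ^ 'm"

definition stencil_based ::
    "nat \<Rightarrow> nat \<Rightarrow> (cell \<Rightarrow> cell set) \<Rightarrow> ('m :: finite) reconstruction \<Rightarrow> bool" where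
  "stencil_based Nx Ny S R \<longleftrightarrow>
     (\<forall>c \<in> cells Nx Ny. S c \<subseteq> cells Nx Ny \<and>
        (\<forall>U V. (\<forall>c' \<in> S c. U c' = V c') \<longrightarrow> R U c = R V c))"

definition two_exact ::
    "nat \<Rightarrow> nat \<Rightarrow> nodes \<Rightarrow> (cell \<Rightarrow> cell set) \<Rightarrow> ('m :: finite) reconstruction \<Rightarrow> bool" where
  "two_exact Nx Ny P S R \<longleftrightarrow>
     (\<forall>c \<in> cells Nx Ny. \<forall>U d. (\<forall>c' \<in> S c. U c' = moment_average (region P c') d) \<longrightarrow>
        (\<forall>z. R U c z = quad_poly d z))"

text \<open>\<open>B U c k g\<close> is the exterior state at Gauss--Lobatto point \<open>g\<close> of a boundary edge \<open>k\<close> of \<open>c\<close>.\<close>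

type_synonym 'm boundary_state = "'m averages \<Rightarrow> cell \<Rightarrow> nat \<Rightarrow> nat \<Rightarrow> real ^ 'm"

definition consistent_boundary ::
    "nat \<Rightarrow> nat \<Rightarrow> nodes \<Rightarrow> ('m :: finite) boundary_state \<Rightarrow> bool" where
  "consistent_boundary Nx Ny P B \<longleftrightarrow>
     (\<forall>U d. (\<forall>c \<in> cells Nx Ny. U c = moment_average (region P c) d) \<longrightarrow>
        (\<forall>c \<in> cells Nx Ny. \<forall>k \<in> {1..4}. neighbour c k \<notin> cells Nx Ny \<longrightarrow>
           (\<forall>g \<in> {1..3}. B U c k g = quad_poly d (lobatto_point P c k g))))"

definition int_state ::
    "nodes \<Rightarrow> ('m :: finite) reconstruction \<Rightarrow> 'm averages \<Rightarrow> cell \<Rightarrow> nat \<Rightarrow> nat \<Rightarrow> real ^ 'm" where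
  "int_state P R U c k g = R U c (lobatto_point P c k g)"

definition ext_state ::
    "nat \<Rightarrow> nat \<Rightarrow> nodes \<Rightarrow> ('m :: finite) reconstruction \<Rightarrow> 'm boundary_state \<Rightarrow>
     'm averages \<Rightarrow> cell \<Rightarrow> nat \<Rightarrow> nat \<Rightarrow> real ^ 'm" where
  "ext_state Nx Ny P R B U c k g =
     (if neighbour c k \<in> cells Nx Ny then R U (neighbour c k) (lobatto_point P c k g)
      else B U c k g)"


section \<open>Conservation law and scheme\<close>

text \<open>A flux is given by its two columns, \<open>F U = (F\<^sub>x U, F\<^sub>y U)\<close>.\<close>

type_synonym 'm flux = "real ^ 'm \<Rightarrow> (real ^ 'm) \<times> (real ^ 'm)"

definition advective_flux :: "plane \<Rightarrow> ('m :: finite) flux" where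
  "advective_flux a U = (fst a *\<^sub>R U, snd a *\<^sub>R U)"

definition normal_flux :: "('m :: finite) flux \<Rightarrow> plane \<Rightarrow> real ^ 'm \<Rightarrow> real ^ 'm" where
  "normal_flux F n U = fst n *\<^sub>R fst (F U) + snd n *\<^sub>R snd (F U)"

definition spectral_radius :: "real ^ 'm ^ 'm \<Rightarrow> real" where
  "spectral_radius A =
     Max {cmod \<mu> | \<mu>. \<exists>v :: complex ^ 'm. v \<noteq> 0 \<and> (\<chi> i j. complex_of_real (A $ i $ j)) *v v = \<mu> *s v}"

text \<open>
  The maximum along an edge is taken over the interior and exterior states at its Gauss--Lobatto
  points. For the advective flux the choice of states is irrelevant, see \<open>max_speed_advective\<close>.
\<close>

definition max_speed :: "('m :: finite) flux \<Rightarrow> plane \<Rightarrow> (real ^ 'm) set \<Rightarrow> real" where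
  "max_speed F n states =
     Max ((\<lambda>U. spectral_radius (jacobian (normal_flux F n) (at U))) ` states)"

lemma spectral_radius_mat: "spectral_radius (mat r :: real ^ 'm ^ 'm) = \<bar>r\<bar>"
proof -
  have "(\<chi> i j. complex_of_real ((mat r :: real ^ 'm ^ 'm) $ i $ j)) = mat (complex_of_real r)"
    by (simp add: vec_eq_iff mat_def)
  moreover have "mat l *v v = l *s v" for l :: complex and v :: "complex ^ 'm"
    by (simp add: vec_eq_iff matrix_vector_mult_def mat_def if_distrib[where f = "\<lambda>x. x * _"]
        cong: if_cong)
  moreover have "\<exists>v :: complex ^ 'm. v \<noteq> 0"
    by (rule exI[of _ 1]) simp
  ultimately have "{cmod \<mu> | \<mu>. \<exists>v :: complex ^ 'm. v \<noteq> 0 \<and>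
      (\<chi> i j. complex_of_real ((mat r :: real ^ 'm ^ 'm) $ i $ j)) *v v = \<mu> *s v} = {\<bar>r\<bar>}"
    by (auto simp: vector_mul_rcancel intro!: exI[of _ "complex_of_real r"])
  then show ?thesis
    by (simp add: spectral_radius_def)
qed

lemma max_speed_advective:
  assumes "states \<noteq> ({} :: (real ^ 'm) set)"
  shows "max_speed (advective_flux a) n states = \<bar>a \<bullet> n\<bar>"
proof -
  have nf: "normal_flux (advective_flux a) n = (\<lambda>U :: real ^ 'm. (a \<bullet> n) *\<^sub>R U)"
    by (simp add: fun_eq_iff normal_flux_def advective_flux_def inner_prod_def algebra_simps)
  have "frechet_derivative (\<lambda>U :: real ^ 'm. (a \<bullet> n) *\<^sub>R U) (at U) = (\<lambda>V. (a \<bullet> n) *\<^sub>R V)" for U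
    by (rule frechet_derivative_at[symmetric]) (auto intro!: derivative_eq_intros)
  then have "jacobian (normal_flux (advective_flux a) n) (at U) = (mat (a \<bullet> n) :: real ^ 'm ^ 'm)" for U
    by (simp add: nf jacobian_def matrix_def mat_def axis_def vec_eq_iff)
  with assms show ?thesis
    by (simp add: max_speed_def spectral_radius_mat image_constant_conv)
qed

definition edge_states ::
    "nat \<Rightarrow> nat \<Rightarrow> nodes \<Rightarrow> ('m :: finite) reconstruction \<Rightarrow> 'm boundary_state \<Rightarrow>
     'm averages \<Rightarrow> cell \<Rightarrow> nat \<Rightarrow> (real ^ 'm) set" where
  "edge_states Nx Ny P R B U c k =
     int_state P R U c k ` {1..3} \<union> ext_state Nx Ny P R B U c k ` {1..3}"

definition fv_operator ::
    "nat \<Rightarrow> nat \<Rightarrow> nodes \<Rightarrow> ('m :: finite) reconstruction \<Rightarrow> 'm boundary_state \<Rightarrow> 'm flux \<Rightarrow>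
     'm averages \<Rightarrow> 'm averages" where
  "fv_operator Nx Ny P R B F U c =
     - (1 / moment (region P c) 0 0) *\<^sub>R
       (\<Sum>k = 1..4. edge_length P c k *\<^sub>R
         (\<Sum>g = 1..3. lobatto_weight g *\<^sub>R (1 / 2) *\<^sub>R
           (let n = outward_normal P c k;
                Ui = int_state P R U c k g;
                Ue = ext_state Nx Ny P R B U c k g
            in normal_flux F n Ui + normal_flux F n Ue
               - max_speed F n (edge_states Nx Ny P R B U c k) *\<^sub>R (Ue - Ui))))"

definition ssprk3_step ::
    "(('m :: finite) averages \<Rightarrow> 'm averages) \<Rightarrow> real \<Rightarrow> 'm averages \<Rightarrow> 'm averages" where
  "ssprk3_step L \<Delta>t U =
     (let U1 = (\<lambda>c. U c + \<Delta>t *\<^sub>R L U c);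
          U2 = (\<lambda>c. (3 / 4) *\<^sub>R U c + (1 / 4) *\<^sub>R (U1 c + \<Delta>t *\<^sub>R L U1 c))
      in (\<lambda>c. (1 / 3) *\<^sub>R U c + (2 / 3) *\<^sub>R (U2 c + \<Delta>t *\<^sub>R L U2 c)))"

text \<open>
  \<open>u\<close> is a differentiable solution on the whole plane, for all times, of
  \<open>\<partial>\<^sub>t u + \<partial>\<^sub>x F\<^sub>x(u) + \<partial>\<^sub>y F\<^sub>y(u) = 0\<close> with data \<open>p\<close> at time \<open>t0\<close>.
\<close>

definition solves_cauchy_problem ::
    "('m :: finite) flux \<Rightarrow> real \<Rightarrow> (plane \<Rightarrow> real ^ 'm) \<Rightarrow> (real \<Rightarrow> plane \<Rightarrow> real ^ 'm) \<Rightarrow> bool" where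
  "solves_cauchy_problem F t0 p u \<longleftrightarrow>
     (\<lambda>(t, z). u t z) differentiable_on UNIV \<and>
     (\<forall>t x y. vector_derivative (\<lambda>\<tau>. u \<tau> (x, y)) (at t)
            + vector_derivative (\<lambda>\<xi>. fst (F (u t (\<xi>, y)))) (at x)
            + vector_derivative (\<lambda>\<eta>. snd (F (u t (x, \<eta>)))) (at y) = 0) \<and>
     u t0 = p"

end

theory Submission
  imports Defs
begin

text \<open>
  If all averages come from one quadratic \<open>q\<close>, then interior and exterior states agree, the dissipation
  vanishes, and the scheme sums the Lobatto quadratures of \<open>(a \<cdot> n) q\<close> over the edges. These are exact for
  quadratics, so by the divergence theorem the spatial operator yields the average of \<open>- a \<cdot> \<nabla>q\<close>. Hence the
  scheme acts on coefficients as \<open>- a \<cdot> \<nabla>\<close>, which is nilpotent of order 3, and SSPRK3 reproduces the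
  exponential of \<open>- \<Delta>t a \<cdot> \<nabla>\<close>, that is, the translation by \<open>\<Delta>t a\<close>. The divergence theorem is only needed
  against the monomials of degree at most 2, where it reduces to polynomial identities in the vertices
  once the moments of degree at most 1 are known; these come from cutting the cell along a diagonal and
  mapping each triangle affinely to the unit triangle. A solution of the Cauchy problem is constant along
  the characteristics \<open>s \<mapsto> (s, z + s a)\<close>, hence unique.
\<close>

section \<open>Integrals of affine functions over a quadrilateral\<close>

text \<open>Gaussian elimination in integral form: iterated integrals and one-dimensional affine
  substitutions, whose two factors multiply to the determinant. For nonnegative functions the order
  of integration may be exchanged without any integrability assumption.\<close>

lemma nn_integral_plane_affine:
  fixes f :: "plane \<Rightarrow> ennreal"
  assumes [measurable]: "f \<in> borel_measurable borel" and det: "cross2 u v \<noteq> 0"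
  shows "(\<integral>\<^sup>+z. f z \<partial>lborel) = ennreal \<bar>cross2 u v\<bar> *
           (\<integral>\<^sup>+z. f (w + fst z *\<^sub>R u + snd z *\<^sub>R v) \<partial>lborel)"
proof -
  obtain u1 u2 v1 v2 w1 w2 where uvw: "u = (u1, u2)" "v = (v1, v2)" "w = (w1, w2)"
    by (metis surj_pair)
  have D: "cross2 u v = u1 * v2 - u2 * v1" by (simp add: uvw cross2_def)
  have [measurable]: "f \<in> borel_measurable (borel \<Otimes>\<^sub>M borel)" by (simp add: borel_prod)
  have L: "lborel = (lborel \<Otimes>\<^sub>M lborel :: plane measure)" by (simp add: lborel_prod)
  have fold: "(\<integral>\<^sup>+z. f z \<partial>lborel) = (\<integral>\<^sup>+x. \<integral>\<^sup>+y. f (x, y) \<partial>lborel \<partial>lborel)"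
    by (subst L, subst lborel.nn_integral_fst[symmetric]) auto
  have G: "(\<integral>\<^sup>+z. f (w + fst z *\<^sub>R u + snd z *\<^sub>R v) \<partial>lborel) =
      (\<integral>\<^sup>+y. \<integral>\<^sup>+x. f (w1 + x * u1 + y * v1, w2 + x * u2 + y * v2) \<partial>lborel \<partial>lborel)"
    by (subst L, subst lborel_pair.nn_integral_snd[symmetric]) (auto simp: uvw)
  show ?thesis
  proof (cases "u1 = 0")
    case False
    \<comment> \<open>\<open>k\<close> is the second pivot \<open>v2 - u2 * v1 / u1\<close>, left
      over after eliminating with the pivot \<open>u1\<close>.\<close>
    define k where "k = cross2 u v / u1"
    have k: "k \<noteq> 0" using False det by (simp add: k_def)
    \<comment> \<open>Taking the first coordinate as the new variable in place of \<open>x\<close>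
      leaves a second coordinate that depends on \<open>y\<close> only through
      \<open>k * y\<close>.\<close>
    have arg: "w2 + (w1 + y * v1 + u1 * x - w1) * u2 / u1 + k * y = w2 + x * u2 + y * v2" for x y
      using False by (simp add: k_def D field_simps)
    have "(\<integral>\<^sup>+x. f (w1 + x * u1 + y * v1, w2 + x * u2 + y * v2) \<partial>lborel) * ennreal \<bar>u1\<bar> =
          (\<integral>\<^sup>+x. f (x, (w2 + (x - w1) * u2 / u1) + k * y) \<partial>lborel)" for y
      using nn_integral_real_affine[OF _ False, of "\<lambda>x. f (x, (w2 + (x - w1) * u2 / u1) + k * y)" "w1 + y * v1"]
      unfolding arg by (simp add: ac_simps)
    moreover have sub: "(\<integral>\<^sup>+y. f (x, t + k * y) \<partial>lborel) * ennreal \<bar>k\<bar> =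
        (\<integral>\<^sup>+y. f (x, y) \<partial>lborel)" for x t
      using nn_integral_real_affine[OF _ k, of "\<lambda>y. f (x, y)" t] by (simp add: mult.commute)
    ultimately have "(\<integral>\<^sup>+z. f (w + fst z *\<^sub>R u + snd z *\<^sub>R v) \<partial>lborel) * ennreal \<bar>u1\<bar> =
       (\<integral>\<^sup>+y. \<integral>\<^sup>+x. f (x, (w2 + (x - w1) * u2 / u1) + k * y) \<partial>lborel \<partial>lborel)"
      unfolding G by (subst nn_integral_multc[symmetric]) auto
    also have "\<dots> = (\<integral>\<^sup>+x. \<integral>\<^sup>+y. f (x, (w2 + (x - w1) * u2 / u1) + k * y) \<partial>lborel \<partial>lborel)"
      by (subst lborel_pair.Fubini') auto
    also have "\<dots> * ennreal \<bar>k\<bar> = (\<integral>\<^sup>+x. \<integral>\<^sup>+y. f (x, y) \<partial>lborel \<partial>lborel)"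
      by (subst nn_integral_multc[symmetric]) (measurable, simp only: sub)
    finally have "(\<integral>\<^sup>+z. f (w + fst z *\<^sub>R u + snd z *\<^sub>R v) \<partial>lborel) * (ennreal \<bar>u1\<bar> * ennreal \<bar>k\<bar>) =
       (\<integral>\<^sup>+z. f z \<partial>lborel)"
      by (simp add: mult.assoc fold)
    moreover have "ennreal \<bar>u1\<bar> * ennreal \<bar>k\<bar> = ennreal \<bar>cross2 u v\<bar>"
      using False by (simp add: ennreal_mult'[symmetric] k_def abs_divide)
    ultimately show ?thesis by (simp add: mult.commute)
  next
    case True
    \<comment> \<open>Now the first coordinate depends on \<open>y\<close> alone, so
      \<open>x\<close> is replaced by the second coordinate, with pivot \<open>u2\<close>, and then
      \<open>y\<close> by the first, with pivot \<open>v1\<close>.\<close>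
    then have nz: "v1 \<noteq> 0" "u2 \<noteq> 0" using det by (auto simp: D)
    have "(\<integral>\<^sup>+x. f (w1 + x * u1 + y * v1, w2 + x * u2 + y * v2) \<partial>lborel) * ennreal \<bar>u2\<bar> =
          (\<integral>\<^sup>+x. f (w1 + v1 * y, x) \<partial>lborel)" for y
      using nn_integral_real_affine[OF _ nz(2), of "\<lambda>x. f (w1 + v1 * y, x)" "w2 + y * v2"] True
      by (simp add: ac_simps)
    then have "(\<integral>\<^sup>+z. f (w + fst z *\<^sub>R u + snd z *\<^sub>R v) \<partial>lborel) * ennreal \<bar>u2\<bar> =
       (\<integral>\<^sup>+y. \<integral>\<^sup>+x. f (w1 + v1 * y, x) \<partial>lborel \<partial>lborel)"
      unfolding G by (subst nn_integral_multc[symmetric]) auto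
    also have "\<dots> * ennreal \<bar>v1\<bar> = (\<integral>\<^sup>+y. \<integral>\<^sup>+x. f (y, x) \<partial>lborel \<partial>lborel)"
      using nn_integral_real_affine[OF _ nz(1), of "\<lambda>y. \<integral>\<^sup>+x. f (y, x) \<partial>lborel" w1]
      by (simp add: mult.commute)
    finally have "(\<integral>\<^sup>+z. f (w + fst z *\<^sub>R u + snd z *\<^sub>R v) \<partial>lborel) * (ennreal \<bar>u2\<bar> * ennreal \<bar>v1\<bar>) =
       (\<integral>\<^sup>+z. f z \<partial>lborel)"
      by (simp add: mult.assoc fold)
    moreover have "ennreal \<bar>u2\<bar> * ennreal \<bar>v1\<bar> = ennreal \<bar>cross2 u v\<bar>"
      by (simp add: ennreal_mult'[symmetric] D True abs_mult)
    ultimately show ?thesis by (simp add: mult.commute)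
  qed
qed

text \<open>Testing the substitution on indicators turns it into an identity of measures, which then
  also serves integrals of signed functions.\<close>

lemma lborel_plane_affine:
  assumes "cross2 u v \<noteq> 0"
  shows "lborel = density (distr lborel borel (\<lambda>z. w + fst z *\<^sub>R u + snd z *\<^sub>R v))
           (\<lambda>_. ennreal \<bar>cross2 u v\<bar>)" (is "_ = density (distr _ _ ?T) _")
proof (rule measure_eqI)
  fix X :: "plane set" assume "X \<in> sets lborel"
  then have [measurable]: "X \<in> sets borel" by simp
  have [measurable]: "?T \<in> borel_measurable borel"
    by (intro borel_measurable_continuous_onI continuous_intros)
  have "emeasure lborel X = (\<integral>\<^sup>+z. indicator X z \<partial>lborel)" by simp
  also have "\<dots> = ennreal \<bar>cross2 u v\<bar> * (\<integral>\<^sup>+z. indicator X (?T z) \<partial>lborel)"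
    by (rule nn_integral_plane_affine[OF _ assms]) simp
  also have "\<dots> = emeasure (density (distr lborel borel ?T) (\<lambda>_. ennreal \<bar>cross2 u v\<bar>)) X"
    using nn_integral_distr[of ?T lborel borel "indicator X"]
    by (simp add: emeasure_density nn_integral_cmult)
  finally show "emeasure lborel X = \<dots>" .
qed simp

lemma set_integral_plane_affine:
  fixes f :: "plane \<Rightarrow> real" and w :: plane
  assumes det: "cross2 u v \<noteq> 0" and f: "f \<in> borel_measurable borel"
    and S: "compact S"
  defines "T \<equiv> \<lambda>z. w + fst z *\<^sub>R u + snd z *\<^sub>R v"
  shows "(LINT z:T ` S|lborel. f z) = \<bar>cross2 u v\<bar> * (LINT z:S|lborel. f (T z))"
proof -
  have cont: "continuous_on UNIV T" unfolding T_def by (intro continuous_intros)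
  have [measurable]: "T \<in> borel_measurable borel"
    using cont by (rule borel_measurable_continuous_onI)
  have [measurable]: "f \<in> borel_measurable borel" by (rule f)
  have "compact (T ` S)" using S cont by (meson compact_continuous_image continuous_on_subset subset_UNIV)
  then have [measurable]: "T ` S \<in> sets borel" by (simp add: borel_compact)
  have "inj T"
  proof (rule injI)
    fix z z' assume "T z = T z'"
    then have *: "(fst z - fst z') *\<^sub>R u + (snd z - snd z') *\<^sub>R v = 0"
      by (simp add: T_def algebra_simps)
    \<comment> \<open>Cramer's rule: the cross products with \<open>v\<close> and with
      \<open>u\<close> isolate the two coefficients.\<close>
    have "(fst z - fst z') * cross2 u v = 0 \<and> (snd z - snd z') * cross2 u v = 0"
      using arg_cong[OF *, of fst] arg_cong[OF *, of snd]
      by (simp add: cross2_def) algebra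
    with det show "z = z'" by (simp add: prod_eq_iff)
  qed
  then have ind: "indicator (T ` S) (T z) = (indicator S z :: real)" for z
    by (auto simp: indicator_def inj_image_mem_iff)
  have "(LINT z:T ` S|lborel. f z) =
     (LINT z|density (distr lborel borel T) (\<lambda>_. ennreal \<bar>cross2 u v\<bar>). indicator (T ` S) z *\<^sub>R f z)"
    unfolding set_lebesgue_integral_def T_def using lborel_plane_affine[OF det, of w] by simp
  also have "\<dots> = \<bar>cross2 u v\<bar> * (LINT z|lborel. indicator (T ` S) (T z) *\<^sub>R f (T z))"
    by (subst integral_density) (auto simp: integral_distr)
  finally show ?thesis by (simp add: ind set_lebesgue_integral_def)
qed

section \<open>Affine integrands on triangles and convex quadrilaterals\<close>

lemma compact_continuous_set_integrable:
  fixes f :: "plane \<Rightarrow> 'a::{banach, second_countable_topology}"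
  assumes "compact K" "continuous_on K f"
  shows "set_integrable lborel K f"
  unfolding set_integrable_def by (rule borel_integrable_compact[OF assms])

lemma integral_unit_triangle:
  "(LINT z:{z. 0 \<le> fst z \<and> 0 \<le> snd z \<and> fst z + snd z \<le> 1}|lborel. \<alpha> + \<beta> * fst z + \<gamma> * snd z) =
     \<alpha> / 2 + \<beta> / 6 + \<gamma> / (6::real)" (is "(LINT z:?S|_. ?f z) = _")
proof -
  have S: "?S = convex hull {(0, 0), (1, 0), (0, 1)}"
    unfolding convex_hull_3_alt by auto
  have "compact ?S" unfolding S by (intro finite_imp_compact_convex_hull) auto
  then have int: "integrable lborel (\<lambda>z. indicator ?S z *\<^sub>R ?f z)"
    by (intro borel_integrable_compact continuous_intros)
  have inner: "(LINT y|lborel. indicator ?S (x, y) *\<^sub>R ?f (x, y)) =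
      ((\<alpha> + \<beta> * x) * (1 - x) + \<gamma> * (1 - x)\<^sup>2 / 2) * indicator {0..1} x" for x
  proof (cases "x \<in> {0..1}")
    case True
    \<comment> \<open>The antiderivative in \<open>y\<close> is kept unsimplified at both endpoints
      to match the fundamental theorem of calculus.\<close>
    have "(LINT y|lborel. (\<alpha> + \<beta> * x + \<gamma> * y) * indicator {0..1 - x} y) =
        ((\<alpha> + \<beta> * x) * (1 - x) + \<gamma> * (1 - x)\<^sup>2 / 2) - ((\<alpha> + \<beta> * x) * 0 + \<gamma> * 0\<^sup>2 / 2)"
      using True by (intro integral_FTC_Icc_real) (auto intro!: derivative_eq_intros)
    moreover have "indicator ?S (x, y) *\<^sub>R ?f (x, y) = (\<alpha> + \<beta> * x + \<gamma> * y) * indicator {0..1 - x} y" for y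
      using True by (auto simp: indicator_def)
    ultimately show ?thesis using True by (simp only:) simp
  next
    case False
    then have "indicator ?S (x, y) = (0::real)" for y by (auto simp: indicator_def)
    with False show ?thesis by simp
  qed
  have "(LINT z:?S|lborel. ?f z) = (LINT x|lborel. LINT y|lborel. indicator ?S (x, y) *\<^sub>R ?f (x, y))"
    using lborel_pair.integral_fst'[of "\<lambda>z. indicator ?S z *\<^sub>R ?f z"] int
    unfolding set_lebesgue_integral_def lborel_prod by simp
  also have "\<dots> = (\<lambda>x. \<alpha> * (x - x^2/2) + \<beta> * (x^2/2 - x^3/3) - \<gamma> * (1 - x)^3 / 6) 1
     - (\<lambda>x. \<alpha> * (x - x^2/2) + \<beta> * (x^2/2 - x^3/3) - \<gamma> * (1 - x)^3 / 6) 0"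
    unfolding inner
    by (intro integral_FTC_Icc_real)
       (auto intro!: derivative_eq_intros simp: field_simps power2_eq_square)
  finally show ?thesis by (simp add: field_simps)
qed

text \<open>After pulling back to the unit triangle, the value is the area times the integrand at
  the centroid; the cross product is twice the area.\<close>

lemma integral_affine_triangle:
  fixes A B C :: plane
  assumes "0 < cross2 (B - A) (C - A)"
  shows "(LINT z:convex hull {A, B, C}|lborel. \<alpha> + \<beta> * fst z + \<gamma> * snd z) =
    cross2 (B - A) (C - A) *
      (\<alpha> / 2 + \<beta> * (fst A + fst B + fst C) / 6 + \<gamma> * (snd A + snd B + snd C) / 6)"
proof -
  let ?S = "{z :: plane. 0 \<le> fst z \<and> 0 \<le> snd z \<and> fst z + snd z \<le> 1}"
  let ?T = "\<lambda>z. A + fst z *\<^sub>R (B - A) + snd z *\<^sub>R (C - A)"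
  have S: "?S = convex hull {(0, 0), (1, 0), (0, 1)}"
    unfolding convex_hull_3_alt by auto
  have "compact ?S" unfolding S by (intro finite_imp_compact_convex_hull) auto
  moreover have "convex hull {A, B, C} = ?T ` ?S"
    unfolding convex_hull_3_alt by (force simp: image_iff)
  ultimately have "(LINT z:convex hull {A, B, C}|lborel. \<alpha> + \<beta> * fst z + \<gamma> * snd z) =
     cross2 (B - A) (C - A) * (LINT z:?S|lborel. \<alpha> + \<beta> * fst (?T z) + \<gamma> * snd (?T z))"
    using set_integral_plane_affine[of "B - A" "C - A" "\<lambda>z. \<alpha> + \<beta> * fst z + \<gamma> * snd z" ?S A] assms
    by (simp add: borel_measurable_continuous_onI continuous_intros)
  also have "(LINT z:?S|lborel. \<alpha> + \<beta> * fst (?T z) + \<gamma> * snd (?T z)) =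
    (LINT z:?S|lborel. (\<alpha> + \<beta> * fst A + \<gamma> * snd A)
       + (\<beta> * fst (B - A) + \<gamma> * snd (B - A)) * fst z
       + (\<beta> * fst (C - A) + \<gamma> * snd (C - A)) * snd z)"
    by (simp add: algebra_simps)
  also have "\<dots> = \<alpha> / 2 + \<beta> * (fst A + fst B + fst C) / 6 + \<gamma> * (snd A + snd B + snd C) / 6"
    unfolding integral_unit_triangle by (simp add: field_simps)
  finally show ?thesis .
qed

lemma convex_quad_split:
  fixes A B C D :: plane
  assumes "0 < cross2 (B - A) (C - A)" "0 < cross2 (C - B) (D - B)"
    "0 < cross2 (D - C) (A - C)" "0 < cross2 (A - D) (B - D)"
  shows "convex hull {A, B, C, D} = convex hull {A, B, C} \<union> convex hull {A, C, D}"
proof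
  define a b c d where "a = cross2 (C - B) (D - B)" and "b = cross2 (D - C) (A - C)"
    and "c = cross2 (A - D) (B - D)" and "d = cross2 (B - A) (C - A)"
  have pos: "a > 0" "b > 0" "c > 0" "d > 0" using assms by (auto simp: a_def b_def c_def d_def)
  \<comment> \<open>Each weight is twice the area of the triangle spanned by the other three vertices; shifting
    barycentric coordinates along this affine relation clears \<open>B\<close> or \<open>D\<close>.\<close>
  have rel: "a *\<^sub>R A + c *\<^sub>R C = b *\<^sub>R B + d *\<^sub>R D"
    by (simp add: prod_eq_iff a_def b_def c_def d_def cross2_def algebra_simps)
  have wts: "a + c = b + d" by (simp add: a_def b_def c_def d_def cross2_def algebra_simps)
  show "convex hull {A, B, C, D} \<subseteq> convex hull {A, B, C} \<union> convex hull {A, C, D}"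
  proof
    fix z assume "z \<in> convex hull {A, B, C, D}"
    then obtain p q r s where nonneg: "p \<ge> 0" "q \<ge> 0" "r \<ge> 0" "s \<ge> 0" and "p + q + r + s = 1"
      and z: "z = p *\<^sub>R A + q *\<^sub>R B + r *\<^sub>R C + s *\<^sub>R D"
    proof -
      obtain u v w where uv: "u \<ge> 0" "v \<ge> 0" "u + v = 1" "w \<in> convex hull {B, C, D}"
        and zw: "z = u *\<^sub>R A + v *\<^sub>R w"
        using \<open>z \<in> convex hull {A, B, C, D}\<close> convex_hull_insert[of "{B, C, D}" A] by auto
      then obtain q r s where qrs: "q \<ge> 0" "r \<ge> 0" "s \<ge> 0" "q + r + s = 1"
        and w: "w = q *\<^sub>R B + r *\<^sub>R C + s *\<^sub>R D"
        unfolding convex_hull_3 by blast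
      have "u + v * q + v * r + v * s = u + v * (q + r + s)" by (simp add: algebra_simps)
      with uv qrs show ?thesis
        by (intro that[of u "v * q" "v * r" "v * s"]) (auto simp: zw w algebra_simps)
    qed
    \<comment> \<open>The largest shift that keeps the weights of \<open>B\<close> and
      \<open>D\<close> nonnegative; one of the two becomes zero.\<close>
    define \<tau> where "\<tau> = min (q / b) (s / d)"
    have l: "\<tau> \<ge> 0" "\<tau> * b \<le> q" "\<tau> * d \<le> s" "\<tau> * b = q \<or> \<tau> * d = s"
      using pos nonneg by (auto simp: \<tau>_def min_def field_simps)
    have z': "z = (p + \<tau> * a) *\<^sub>R A + (q - \<tau> * b) *\<^sub>R B + (r + \<tau> * c) *\<^sub>R C + (s - \<tau> * d) *\<^sub>R D"
      using arg_cong[OF rel, of "scaleR \<tau>"] by (simp add: z algebra_simps)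
    have sum: "(p + \<tau> * a) + (q - \<tau> * b) + (r + \<tau> * c) + (s - \<tau> * d) = 1"
      using \<open>p + q + r + s = 1\<close> arg_cong[OF wts, of "(*) \<tau>"] by (simp add: algebra_simps)
    have "p + \<tau> * a \<ge> 0" "r + \<tau> * c \<ge> 0" using l pos nonneg by auto
    from l(4) show "z \<in> convex hull {A, B, C} \<union> convex hull {A, C, D}"
    proof
      assume "\<tau> * b = q"
      with z' sum have "z = (p + \<tau> * a) *\<^sub>R A + (r + \<tau> * c) *\<^sub>R C + (s - \<tau> * d) *\<^sub>R D"
        "(p + \<tau> * a) + (r + \<tau> * c) + (s - \<tau> * d) = 1" by auto
      then have "z \<in> convex hull {A, C, D}"
        using l(3) \<open>p + \<tau> * a \<ge> 0\<close> \<open>r + \<tau> * c \<ge> 0\<close>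
        unfolding convex_hull_3 mem_Collect_eq by (metis diff_ge_0_iff_ge)
      then show ?thesis ..
    next
      assume "\<tau> * d = s"
      with z' sum have "z = (p + \<tau> * a) *\<^sub>R A + (q - \<tau> * b) *\<^sub>R B + (r + \<tau> * c) *\<^sub>R C"
        "(p + \<tau> * a) + (q - \<tau> * b) + (r + \<tau> * c) = 1" by auto
      then have "z \<in> convex hull {A, B, C}"
        using l(2) \<open>p + \<tau> * a \<ge> 0\<close> \<open>r + \<tau> * c \<ge> 0\<close>
        unfolding convex_hull_3 mem_Collect_eq by (metis diff_ge_0_iff_ge)
      then show ?thesis ..
    qed
  qed
  show "convex hull {A, B, C} \<union> convex hull {A, C, D} \<subseteq> convex hull {A, B, C, D}"
    by (intro Un_least hull_mono) auto
qed

text \<open>The diagonal from \<open>A\<close> to \<open>C\<close> separates the two triangles: they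
  lie in opposite closed half-planes of that line, so their overlap is a null set and the integrals
  add.\<close>

lemma integral_affine_quad:
  fixes A B C D :: plane
  assumes "0 < cross2 (B - A) (C - A)" "0 < cross2 (C - B) (D - B)"
    "0 < cross2 (D - C) (A - C)" "0 < cross2 (A - D) (B - D)"
  shows "(LINT z:convex hull {A, B, C, D}|lborel. \<alpha> + \<beta> * fst z + \<gamma> * snd z) =
    cross2 (B - A) (C - A) *
      (\<alpha> / 2 + \<beta> * (fst A + fst B + fst C) / 6 + \<gamma> * (snd A + snd B + snd C) / 6) +
    cross2 (C - A) (D - A) *
      (\<alpha> / 2 + \<beta> * (fst A + fst C + fst D) / 6 + \<gamma> * (snd A + snd C + snd D) / 6)"
proof -
  define h where "h z = cross2 (C - A) (z - A)" for z
  have ACD: "0 < cross2 (C - A) (D - A)" using assms(3) by (simp add: cross2_def algebra_simps)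
  define n :: plane where "n = (- snd (C - A), fst (C - A))"
  have h: "h z = n \<bullet> (z - A)" for z
    by (cases z; cases A) (simp add: h_def n_def cross2_def inner_prod_def algebra_simps)
  have "n \<noteq> 0" using ACD by (auto simp: n_def cross2_def prod_eq_iff)
  have "h z \<le> 0" if "z \<in> convex hull {A, B, C}" for z
  proof -
    have "convex hull {A, B, C} \<subseteq> {z. n \<bullet> z \<le> n \<bullet> A}"
    proof (rule hull_minimal)
      show "{A, B, C} \<subseteq> {z. n \<bullet> z \<le> n \<bullet> A}"
        using assms(1) by (auto simp: n_def cross2_def inner_prod_def algebra_simps)
    qed (rule convex_halfspace_le)
    with that show ?thesis by (auto simp: h inner_diff_right)
  qed
  moreover have "h z \<ge> 0" if "z \<in> convex hull {A, C, D}" for z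
  proof -
    have "convex hull {A, C, D} \<subseteq> {z. n \<bullet> z \<ge> n \<bullet> A}"
    proof (rule hull_minimal)
      show "{A, C, D} \<subseteq> {z. n \<bullet> z \<ge> n \<bullet> A}"
        using ACD by (auto simp: n_def cross2_def inner_prod_def algebra_simps)
    qed (rule convex_halfspace_ge)
    with that show ?thesis by (auto simp: h inner_diff_right)
  qed
  ultimately have sub: "convex hull {A, B, C} \<inter> convex hull {A, C, D} \<subseteq> {z. n \<bullet> z = n \<bullet> A}"
    by (force simp: h inner_diff_right)
  \<comment> \<open>Negligibility of a line is a statement about Lebesgue measure; as the line is a
    Borel set, it descends to \<open>lborel\<close>.\<close>
  have "AE z in lebesgue. z \<notin> {z. n \<bullet> z = n \<bullet> A}"
    using negligible_hyperplane[of n "n \<bullet> A"] \<open>n \<noteq> 0\<close>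
    by (intro AE_not_in) (simp add: negligible_iff_null_sets)
  moreover have "{z. n \<bullet> z = n \<bullet> A} \<in> sets borel"
    by (intro borel_closed closed_hyperplane)
  ultimately have "AE z in lborel. z \<notin> {z. n \<bullet> z = n \<bullet> A}"
    by (subst (asm) AE_completion_iff) auto
  then have ae: "AE z in lborel. \<not> (z \<in> convex hull {A, B, C} \<and> z \<in> convex hull {A, C, D})"
    using sub by (auto elim: eventually_mono)
  have cpt: "compact (convex hull {A, B, C})" "compact (convex hull {A, C, D})"
    by (intro finite_imp_compact_convex_hull; simp)+
  then have "(LINT z:convex hull {A, B, C, D}|lborel. \<alpha> + \<beta> * fst z + \<gamma> * snd z) =
    (LINT z:convex hull {A, B, C}|lborel. \<alpha> + \<beta> * fst z + \<gamma> * snd z) +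
    (LINT z:convex hull {A, C, D}|lborel. \<alpha> + \<beta> * fst z + \<gamma> * snd z)"
    unfolding convex_quad_split[OF assms] using ae
    by (intro set_integral_Un_AE compact_continuous_set_integrable continuous_intros)
       (auto intro: borel_compact)
  then show ?thesis by (simp add: integral_affine_triangle assms ACD)
qed

section \<open>Averages of quadratics and Lobatto fluxes\<close>

lemma quad_poly_expand:
  "quad_poly d z = d 0 0 + snd z *\<^sub>R d 0 1 + (snd z)\<^sup>2 *\<^sub>R d 0 2 + fst z *\<^sub>R d 1 0
     + (fst z * snd z) *\<^sub>R d 1 1 + (fst z)\<^sup>2 *\<^sub>R d 2 0"
  by (simp add: quad_poly_def case_prod_beta numeral_2_eq_2 atMost_Suc add.commute add.left_commute)

lemma moment_average_expand:
  "moment_average K d = (1 / moment K 0 0) *\<^sub>R (moment K 0 0 *\<^sub>R d 0 0 + moment K 0 1 *\<^sub>R d 0 1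
     + moment K 0 2 *\<^sub>R d 0 2 + moment K 1 0 *\<^sub>R d 1 0 + moment K 1 1 *\<^sub>R d 1 1 + moment K 2 0 *\<^sub>R d 2 0)"
  by (simp add: moment_average_def numeral_2_eq_2 atMost_Suc add.commute add.left_commute)

text \<open>Linearity in the coefficients allows the time stepping to be carried out on coefficients
  instead of averages.\<close>

lemma moment_average_combination:
  "\<alpha> *\<^sub>R moment_average K d + \<beta> *\<^sub>R moment_average K e =
     moment_average K (\<lambda>s r. \<alpha> *\<^sub>R d s r + \<beta> *\<^sub>R e s r)"
  by (simp add: moment_average_def vec_eq_iff sum.distrib sum_distrib_left sum_divide_distrib
      algebra_simps add_divide_distrib)

lemma cell_average_quad_poly:
  fixes d :: "nat \<Rightarrow> nat \<Rightarrow> real ^ ('m :: finite)"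
  assumes "compact K"
  shows "cell_average K (quad_poly d) = moment_average K d"
proof -
  have int: "integrable lborel (\<lambda>z. indicator K z *\<^sub>R (fst z ^ s * snd z ^ r))" for s r :: nat
    using compact_continuous_set_integrable[OF assms, of "\<lambda>z. fst z ^ s * snd z ^ r"]
    by (simp add: set_integrable_def continuous_intros)
  have "(LINT z:K|lborel. quad_poly d z) =
      (LINT z|lborel. (\<Sum>s\<le>2. \<Sum>r\<le>2 - s. (indicator K z *\<^sub>R (fst z ^ s * snd z ^ r)) *\<^sub>R d s r))"
    by (simp add: set_lebesgue_integral_def quad_poly_def case_prod_beta scaleR_sum_right)
  also have "\<dots> = (\<Sum>s\<le>2. \<Sum>r\<le>2 - s. moment K s r *\<^sub>R d s r)"
    using int by (simp add: moment_def set_lebesgue_integral_def)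
  finally show ?thesis
    by (simp add: cell_average_def moment_average_def moment_def[of K 0 0] set_lebesgue_integral_def)
qed

lemma region_quad:
  "region P c = convex hull {vertex P c 1, vertex P c 2, vertex P c 3, vertex P c 4}"
proof -
  have "{1..4 :: nat} = {1, 2, 3, 4}" by auto
  then show ?thesis by (simp add: region_def)
qed

lemma compact_region: "compact (region P c)"
  unfolding region_quad by (intro finite_imp_compact_convex_hull) auto

lemma vertex_5: "vertex P c 5 = vertex P c 1"
  and vertex_6: "vertex P c 6 = vertex P c 2"
  by (simp_all add: vertex_def case_prod_beta)

text \<open>Degree at most 1 suffices because directional derivatives of quadratics are
  affine.\<close>

lemma quad_mesh_affine_moments:
  assumes "quad_mesh Nx Ny P" "c \<in> cells Nx Ny"
  defines "A \<equiv> vertex P c 1" and "B \<equiv> vertex P c 2" and "C \<equiv> vertex P c 3" and "D \<equiv> vertex P c 4"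
  shows "moment (region P c) 0 0 = (cross2 (B - A) (C - A) + cross2 (C - A) (D - A)) / 2" (is ?M00)
    and "moment (region P c) 1 0 = (cross2 (B - A) (C - A) * (fst A + fst B + fst C)
      + cross2 (C - A) (D - A) * (fst A + fst C + fst D)) / 6" (is ?M10)
    and "moment (region P c) 0 1 = (cross2 (B - A) (C - A) * (snd A + snd B + snd C)
      + cross2 (C - A) (D - A) * (snd A + snd C + snd D)) / 6" (is ?M01)
    and "moment (region P c) 0 0 \<noteq> 0"
proof -
  have turn: "0 < cross2 (vertex P c (k + 1) - vertex P c k) (vertex P c (k + 2) - vertex P c (k + 1))"
    if "k \<in> {1..4}" for k using assms(1,2) that by (auto simp: quad_mesh_def)
  \<comment> \<open>The turns for \<open>k = 3\<close> and \<open>k = 4\<close> reach vertices 5 and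
    6, which are 1 and 2 again.\<close>
  have pos: "0 < cross2 (B - A) (C - A)" "0 < cross2 (C - B) (D - B)"
    "0 < cross2 (D - C) (A - C)" "0 < cross2 (A - D) (B - D)"
    using turn[of 1] turn[of 2] turn[of 3] turn[of 4] vertex_5[of P c] vertex_6[of P c]
    by (simp_all add: A_def B_def C_def D_def cross2_def algebra_simps numeral_eq_Suc)
  note int = integral_affine_quad[OF pos, folded region_quad[of P c, folded A_def B_def C_def D_def]]
  show M00: ?M00 using int[of 1 0 0] by (simp add: moment_def)
  show ?M10 using int[of 0 1 0] by (simp add: moment_def)
  show ?M01 using int[of 0 0 1] by (simp add: moment_def)
  have "cross2 (C - A) (D - A) > 0" using pos(3) by (simp add: cross2_def algebra_simps)
  with pos(1) show "moment (region P c) 0 0 \<noteq> 0" unfolding M00 by simp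
qed

section \<open>The spatial operator on averages of a quadratic\<close>

lemma sum_atLeast1_atMost4: "(\<Sum>k = 1..4 :: nat. f k) = f 1 + f 2 + f 3 + f 4"
  for f :: "nat \<Rightarrow> 'a :: comm_monoid_add"
  by (simp add: numeral_eq_Suc atLeastAtMostSuc_conv ac_simps)

lemma sum_atLeast1_atMost3: "(\<Sum>k = 1..3 :: nat. f k) = f 1 + f 2 + f 3"
  for f :: "nat \<Rightarrow> 'a :: comm_monoid_add"
  by (simp add: numeral_eq_Suc atLeastAtMostSuc_conv ac_simps)

text \<open>Lobatto quadrature of the boundary integral of \<open>q\<close> times the normal
  component of \<open>a\<close>. The cross product with the edge vector already contains the edge
  length, so no normalisation occurs. The general value type covers both scalar monomials and
  vector-valued quadratics.\<close>

definition lobatto_flux :: "nodes \<Rightarrow> cell \<Rightarrow> plane \<Rightarrow> (plane \<Rightarrow> 'a :: real_vector) \<Rightarrow> 'a" where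
  "lobatto_flux P c a q = (\<Sum>k = 1..4. cross2 a (vertex P c (k + 1) - vertex P c k) *\<^sub>R
     (\<Sum>g = 1..3. lobatto_weight g *\<^sub>R q (lobatto_point P c k g)))"

lemma lobatto_flux_eval:
  "lobatto_flux P c a q = (\<Sum>k = 1..4. cross2 a (vertex P c (k + 1) - vertex P c k) *\<^sub>R
     ((1 / 6) *\<^sub>R q (vertex P c k)
       + (2 / 3) *\<^sub>R q ((1 / 2) *\<^sub>R (vertex P c k + vertex P c (k + 1)))
       + (1 / 6) *\<^sub>R q (vertex P c (k + 1))))"
  unfolding lobatto_flux_def sum_atLeast1_atMost3
  by (simp add: lobatto_weight_def lobatto_point_def midpoint_def)

text \<open>Each right-hand side is the integral over the cell of the derivative of the monomial
  along \<open>a\<close>, as the divergence theorem and the exactness of Simpson's rule predict. In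
  vertex coordinates both sides are polynomials, so expansion decides the equalities.\<close>

lemma lobatto_flux_monomials:
  assumes "quad_mesh Nx Ny P" "c \<in> cells Nx Ny"
  defines "M \<equiv> moment (region P c)"
  shows "lobatto_flux P c a (\<lambda>z. 1 :: real) = 0"
    and "lobatto_flux P c a fst = fst a * M 0 0"
    and "lobatto_flux P c a snd = snd a * M 0 0"
    and "lobatto_flux P c a (\<lambda>z. (fst z)\<^sup>2) = 2 * fst a * M 1 0"
    and "lobatto_flux P c a (\<lambda>z. fst z * snd z) = fst a * M 0 1 + snd a * M 1 0"
    and "lobatto_flux P c a (\<lambda>z. (snd z)\<^sup>2) = 2 * snd a * M 0 1"
proof -
  obtain A1 A2 B1 B2 C1 C2 D1 D2 where v: "vertex P c 1 = (A1, A2)" "vertex P c 2 = (B1, B2)"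
    "vertex P c 3 = (C1, C2)" "vertex P c 4 = (D1, D2)" by (metis surj_pair)
  note unf = lobatto_flux_eval sum_atLeast1_atMost4 M_def quad_mesh_affine_moments(1-3)[OF assms(1,2)]
  have *: "vertex P c (1 + 1) = (B1, B2)" "vertex P c (2 + 1) = (C1, C2)"
    "vertex P c (3 + 1) = (D1, D2)" "vertex P c (4 + 1) = (A1, A2)"
    using v vertex_5[of P c] by (simp_all add: numeral_eq_Suc)
  show "lobatto_flux P c a (\<lambda>z. 1 :: real) = 0"
    "lobatto_flux P c a fst = fst a * M 0 0"
    "lobatto_flux P c a snd = snd a * M 0 0"
    "lobatto_flux P c a (\<lambda>z. (fst z)\<^sup>2) = 2 * fst a * M 1 0"
    "lobatto_flux P c a (\<lambda>z. fst z * snd z) = fst a * M 0 1 + snd a * M 1 0"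
    "lobatto_flux P c a (\<lambda>z. (snd z)\<^sup>2) = 2 * snd a * M 0 1"
    unfolding unf * v by (simp_all add: cross2_def field_simps power2_eq_square)
qed

text \<open>
  Coefficients of \<open>- a \<cdot> \<nabla>q\<close> for the quadratic \<open>q\<close> with coefficients \<open>d\<close>. The guard discards the entries
  of \<open>d\<close> of degree above 2, which are arbitrary.
\<close>

definition advect_coeffs ::
    "plane \<Rightarrow> (nat \<Rightarrow> nat \<Rightarrow> real ^ 'm) \<Rightarrow> nat \<Rightarrow> nat \<Rightarrow> real ^ ('m :: finite)" where
  "advect_coeffs a d s r =
     (if s + r < 2 then - (fst a * real (s + 1)) *\<^sub>R d (s + 1) r - (snd a * real (r + 1)) *\<^sub>R d s (r + 1)
      else 0)"

lemma lobatto_flux_quad_poly: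
  "lobatto_flux P c a (quad_poly d) =
     lobatto_flux P c a (\<lambda>z. 1) *\<^sub>R d 0 0 + lobatto_flux P c a snd *\<^sub>R d 0 1
     + lobatto_flux P c a (\<lambda>z. (snd z)\<^sup>2) *\<^sub>R d 0 2 + lobatto_flux P c a fst *\<^sub>R d 1 0
     + lobatto_flux P c a (\<lambda>z. fst z * snd z) *\<^sub>R d 1 1
     + lobatto_flux P c a (\<lambda>z. (fst z)\<^sup>2) *\<^sub>R d 2 0"
  by (simp add: lobatto_flux_def quad_poly_expand[abs_def] vec_eq_iff sum.distrib algebra_simps
      sum_distrib_left sum_distrib_right)

lemma lobatto_flux_quad_poly_moment_average:
  assumes "quad_mesh Nx Ny P" "c \<in> cells Nx Ny"
  shows "- (1 / moment (region P c) 0 0) *\<^sub>R lobatto_flux P c a (quad_poly d) =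
     moment_average (region P c) (advect_coeffs a d)"
  unfolding lobatto_flux_quad_poly lobatto_flux_monomials[OF assms] moment_average_expand
  by (simp add: advect_coeffs_def vec_eq_iff algebra_simps numeral_2_eq_2)

lemma edge_length_outward_normal:
  "edge_length P c k * (a \<bullet> outward_normal P c k) = cross2 a (vertex P c (k + 1) - vertex P c k)"
proof -
  define e where "e = vertex P c (k + 1) - vertex P c k"
  have "edge_length P c k = norm e" by (simp add: edge_length_def e_def dist_norm norm_minus_commute)
  moreover have "a \<bullet> outward_normal P c k = cross2 a e / norm e"
    unfolding outward_normal_def Let_def e_def[symmetric]
    by (cases a) (simp add: inner_prod_def cross2_def diff_divide_distrib)
  \<comment> \<open>For an edge of length zero the division yields 0, and both sides vanish.\<close>
  moreover have "cross2 a e = 0" if "norm e = 0" using that by (simp add: cross2_def)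
  ultimately show ?thesis by (simp add: e_def)
qed

lemma normal_flux_advective: "normal_flux (advective_flux a) n U = (a \<bullet> n) *\<^sub>R U"
  by (simp add: normal_flux_def advective_flux_def inner_prod_def algebra_simps)

lemma fv_operator_moment_average:
  fixes R :: "('m :: finite) reconstruction"
  assumes mesh: "quad_mesh Nx Ny P"
    and stencil: "stencil_based Nx Ny S R"
    and exact: "two_exact Nx Ny P S R"
    and boundary: "consistent_boundary Nx Ny P B"
    and U: "\<And>c. c \<in> cells Nx Ny \<Longrightarrow> U c = moment_average (region P c) d"
    and c: "c \<in> cells Nx Ny"
  shows "fv_operator Nx Ny P R B (advective_flux a) U c = moment_average (region P c) (advect_coeffs a d)"
proof -
  \<comment> \<open>The stencil lies inside the mesh, so \<open>U\<close> supplies the premise of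
    2-exactness with the same \<open>d\<close> for every cell.\<close>
  have rec: "R U c' z = quad_poly d z" if "c' \<in> cells Nx Ny" for c' z
    using exact stencil U that unfolding two_exact_def stencil_based_def by blast
  have int: "int_state P R U c k g = quad_poly d (lobatto_point P c k g)" for k g
    by (simp add: int_state_def rec c)
  have ext: "ext_state Nx Ny P R B U c k g = quad_poly d (lobatto_point P c k g)"
    if "k \<in> {1..4}" "g \<in> {1..3}" for k g
    using boundary U c that by (auto simp: ext_state_def rec consistent_boundary_def)
  \<comment> \<open>The jump is zero, so the wave speed need not be evaluated. Congruence under the
    sums keeps \<open>k\<close> and \<open>g\<close> in the ranges that \<open>ext\<close>
    requires.\<close>
  have "fv_operator Nx Ny P R B (advective_flux a) U c =
      - (1 / moment (region P c) 0 0) *\<^sub>R (\<Sum>k = 1..4. edge_length P c k *\<^sub>R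
         (\<Sum>g = 1..3. lobatto_weight g *\<^sub>R (1 / 2) *\<^sub>R
           (2 *\<^sub>R (a \<bullet> outward_normal P c k) *\<^sub>R quad_poly d (lobatto_point P c k g))))"
    unfolding fv_operator_def Let_def
    by (intro arg_cong2[where f = scaleR] sum.cong refl)
       (simp only: int ext normal_flux_advective scaleR_2 diff_self scaleR_zero_right diff_zero)
  also have "\<dots> = - (1 / moment (region P c) 0 0) *\<^sub>R lobatto_flux P c a (quad_poly d)"
    unfolding lobatto_flux_def edge_length_outward_normal[symmetric]
    by (simp add: scaleR_sum_right mult.commute mult.left_commute)
  finally show ?thesis by (simp only: lobatto_flux_quad_poly_moment_average[OF mesh c])
qed

section \<open>One SSPRK3 step as a translation of the quadratic\<close>

text \<open>
  SSPRK3 on a linear problem is the Taylor polynomial of degree 3; its cubic term vanishes here because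
  third derivatives of quadratics do.
\<close>

definition ssprk3_coeffs ::
    "plane \<Rightarrow> real \<Rightarrow> (nat \<Rightarrow> nat \<Rightarrow> real ^ 'm) \<Rightarrow> nat \<Rightarrow> nat \<Rightarrow> real ^ ('m :: finite)" where
  "ssprk3_coeffs a h d s r = d s r + h *\<^sub>R advect_coeffs a d s r
     + (h\<^sup>2 / 2) *\<^sub>R advect_coeffs a (advect_coeffs a d) s r"

text \<open>Every stage again consists of averages of a single quadratic on all of \<open>I\<close>,
  so the hypothesis on \<open>L\<close> applies anew at each stage, with \<open>d\<close>,
  \<open>d1\<close> and \<open>d2\<close> in turn.\<close>

lemma ssprk3_step_moment_average:
  fixes L :: "('m :: finite) averages \<Rightarrow> 'm averages"
  assumes L: "\<And>V e c. (\<And>c. c \<in> I \<Longrightarrow> V c = moment_average (K c) e) \<Longrightarrow> c \<in> I \<Longrightarrow>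
      L V c = moment_average (K c) (advect_coeffs a e)"
    and U: "\<And>c. c \<in> I \<Longrightarrow> U c = moment_average (K c) d"
    and c: "c \<in> I"
  shows "ssprk3_step L h U c = moment_average (K c) (ssprk3_coeffs a h d)"
proof -
  define d1 where "d1 s r = d s r + h *\<^sub>R advect_coeffs a d s r" for s r
  define d2 where "d2 s r = (3 / 4) *\<^sub>R d s r + (1 / 4) *\<^sub>R (d1 s r + h *\<^sub>R advect_coeffs a d1 s r)" for s r
  define U1 where "U1 = (\<lambda>c. U c + h *\<^sub>R L U c)"
  define U2 where "U2 = (\<lambda>c. (3 / 4) *\<^sub>R U c + (1 / 4) *\<^sub>R (U1 c + h *\<^sub>R L U1 c))"
  have LU: "L U c = moment_average (K c) (advect_coeffs a d)" if "c \<in> I" for c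
    using L U that by blast
  have U1: "U1 c = moment_average (K c) d1" if "c \<in> I" for c
    unfolding U1_def LU[OF that] U[OF that] d1_def
    using moment_average_combination[of 1 "K c" d h] by simp
  then have LU1: "L U1 c = moment_average (K c) (advect_coeffs a d1)" if "c \<in> I" for c
    using L that by blast
  have U2: "U2 c = moment_average (K c) d2" if "c \<in> I" for c
    unfolding U2_def LU1[OF that] U1[OF that] U[OF that] d2_def
    using moment_average_combination[of 1 "K c" d1 h] by (simp add: moment_average_combination)
  then have LU2: "L U2 c = moment_average (K c) (advect_coeffs a d2)" if "c \<in> I" for c
    using L that by blast
  have "ssprk3_step L h U c = (1 / 3) *\<^sub>R U c + (2 / 3) *\<^sub>R (U2 c + h *\<^sub>R L U2 c)"
    by (simp add: ssprk3_step_def Let_def U2_def U1_def)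
  also have "\<dots> = moment_average (K c)
      (\<lambda>s r. (1 / 3) *\<^sub>R d s r + (2 / 3) *\<^sub>R (d2 s r + h *\<^sub>R advect_coeffs a d2 s r))"
    unfolding LU2[OF c] U2[OF c] U[OF c]
    using moment_average_combination[of 1 "K c" d2 h] by (simp add: moment_average_combination)
  \<comment> \<open>Writing A for \<open>h\<close> times \<open>advect_coeffs a\<close>, the
    coefficients \<open>d2\<close> are (1 + A/2 + A^2/4) d, and the full step gives (1 + A + A^2/2 +
    A^3/6) d, where A^3 = 0.\<close>
  also have "\<dots> = moment_average (K c) (ssprk3_coeffs a h d)"
    by (simp add: moment_average_expand ssprk3_coeffs_def d1_def d2_def advect_coeffs_def
        vec_eq_iff field_simps numeral_2_eq_2)
  finally show ?thesis .
qed

text \<open>This is the Taylor expansion at \<open>z\<close> with increment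
  \<open>- h *\<^sub>R a\<close>, which for a quadratic ends at second order.\<close>

lemma quad_poly_ssprk3_coeffs: "quad_poly (ssprk3_coeffs a h d) z = quad_poly d (z - h *\<^sub>R a)"
  unfolding quad_poly_expand ssprk3_coeffs_def advect_coeffs_def
  by (simp add: vec_eq_iff power2_eq_square field_simps numeral_2_eq_2)

text \<open>The inner double sum is, formally, the integral of the translated monomial expanded by
  the binomial theorem. The claim only regroups finitely many terms, from one coefficient per moment
  to one combination of moments per coefficient.\<close>

lemma moment_average_ssprk3_coeffs:
  "moment_average K (ssprk3_coeffs (a\<^sub>x, a\<^sub>y) h d) = (1 / moment K 0 0) *\<^sub>R
     (\<Sum>s\<le>2. \<Sum>r\<le>2 - s.
       (\<Sum>k\<le>s. \<Sum>l\<le>r. real (s choose k) * real (r choose l)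
         * (- a\<^sub>x * h) ^ (s - k) * (- a\<^sub>y * h) ^ (r - l) * moment K k l) *\<^sub>R d s r)"
  unfolding moment_average_def ssprk3_coeffs_def advect_coeffs_def
  by (simp add: numeral_2_eq_2 atMost_Suc vec_eq_iff algebra_simps power2_eq_square)

section \<open>The Cauchy problem\<close>

text \<open>By the chain rule the three partial derivatives are values of \<open>G\<close> at the
  coordinate directions, so linearity combines them into the derivative along the characteristic
  direction.\<close>

lemma advection_residual:
  fixes u :: "real \<Rightarrow> plane \<Rightarrow> real ^ 'm :: finite"
  assumes G: "((\<lambda>(t, z). u t z) has_derivative G) (at (t, x, y))"
  shows "vector_derivative (\<lambda>\<tau>. u \<tau> (x, y)) (at t)
       + vector_derivative (\<lambda>\<xi>. fst (advective_flux a (u t (\<xi>, y)))) (at x)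
       + vector_derivative (\<lambda>\<eta>. snd (advective_flux a (u t (x, \<eta>)))) (at y) = G (1, a)"
proof -
  interpret G: bounded_linear G using G by (rule has_derivative_bounded_linear)
  have along: "((\<lambda>\<tau>. (\<lambda>(t, z). u t z) (\<gamma> \<tau>)) has_vector_derivative G v) (at s)"
    if "\<gamma> s = (t, x, y)" "(\<gamma> has_vector_derivative v) (at s)" for \<gamma> s v
    using has_derivative_compose[of \<gamma> "\<lambda>h. h *\<^sub>R v" s UNIV "\<lambda>(t, z). u t z" G] that G
    by (simp add: has_vector_derivative_def G.scaleR)
  have "((\<lambda>\<tau>. u \<tau> (x, y)) has_vector_derivative G (1, 0, 0)) (at t)"
    using along[of "\<lambda>\<tau>. (\<tau>, x, y)" t "(1, 0, 0)"]
    by (simp add: has_vector_derivative_Pair has_vector_derivative_const has_vector_derivative_id)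
  moreover have "((\<lambda>\<xi>. fst (advective_flux a (u t (\<xi>, y)))) has_vector_derivative
      fst a *\<^sub>R G (0, 1, 0)) (at x)"
    using along[of "\<lambda>\<xi>. (t, \<xi>, y)" x "(0, 1, 0)"] unfolding advective_flux_def
    by (auto intro!: bounded_linear.has_vector_derivative[OF bounded_linear_scaleR_right]
        simp: has_vector_derivative_Pair has_vector_derivative_const has_vector_derivative_id)
  moreover have "((\<lambda>\<eta>. snd (advective_flux a (u t (x, \<eta>)))) has_vector_derivative
      snd a *\<^sub>R G (0, 0, 1)) (at y)"
    using along[of "\<lambda>\<eta>. (t, x, \<eta>)" y "(0, 0, 1)"] unfolding advective_flux_def
    by (auto intro!: bounded_linear.has_vector_derivative[OF bounded_linear_scaleR_right]
        simp: has_vector_derivative_Pair has_vector_derivative_const has_vector_derivative_id)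
  moreover have "G (1, a) = G (1, 0, 0) + fst a *\<^sub>R G (0, 1, 0) + snd a *\<^sub>R G (0, 0, 1)"
    by (simp flip: G.add G.scaleR)
  ultimately show ?thesis by (simp add: vector_derivative_at)
qed

text \<open>The equation says that the total derivative of \<open>u\<close> annihilates
  \<open>(1, a)\<close>. Forwards, \<open>u\<close> is therefore constant on characteristic lines
  and determined by its data; backwards, the derivative of the translated \<open>p\<close> sends
  \<open>(1, a)\<close> to the derivative of \<open>p\<close> applied to
  \<open>a - a\<close>.\<close>

lemma solves_advection_iff:
  fixes p :: "plane \<Rightarrow> real ^ 'm :: finite"
  assumes "\<And>z. p differentiable (at z)"
  shows "solves_cauchy_problem (advective_flux a) t0 p u \<longleftrightarrow> u = (\<lambda>t z. p (z - (t - t0) *\<^sub>R a))"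
    (is "_ \<longleftrightarrow> u = ?v")
proof
  assume sol: "solves_cauchy_problem (advective_flux a) t0 p u"
  let ?G = "\<lambda>q. frechet_derivative (\<lambda>(t, z). u t z) (at q)"
  have G: "((\<lambda>(t, z). u t z) has_derivative ?G q) (at q)" for q
    using sol unfolding solves_cauchy_problem_def differentiable_on_def
    by (simp only: frechet_derivative_works[symmetric] ball_simps)
  have zero: "?G (t, z) (1, a) = 0" for t z
    using sol advection_residual[OF G[of "(t, fst z, snd z)"], of a]
    unfolding solves_cauchy_problem_def by (metis prod.collapse)
  show "u = ?v"
  proof (intro ext)
    fix t z
    \<comment> \<open>The characteristic through \<open>(t, z)\<close>; at time \<open>t0\<close> it
      sits at the point where \<open>?v\<close> evaluates \<open>p\<close>.\<close>
    let ?\<gamma> = "\<lambda>s. (s, z + (s - t) *\<^sub>R a)"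
    have \<gamma>: "(?\<gamma> has_derivative (\<lambda>h. h *\<^sub>R (1, a))) (at s)" for s
      by (auto intro!: derivative_eq_intros)
    have "?G (s, z') (h *\<^sub>R (1, a)) = 0" for s z' h
      using bounded_linear.linear[OF has_derivative_bounded_linear[OF G[of "(s, z')"]]]
      by (simp only: linear_scale zero scaleR_zero_right)
    then have "((\<lambda>s. (\<lambda>(t, z). u t z) (?\<gamma> s)) has_derivative (\<lambda>h. 0)) (at s)" for s
      using has_derivative_compose[OF \<gamma> G] by simp
    then have "(\<lambda>(t, z). u t z) (?\<gamma> t) = (\<lambda>(t, z). u t z) (?\<gamma> t0)"
      by (intro has_derivative_zero_unique[of UNIV]) auto
    then show "u t z = ?v t z"
      using sol by (simp add: solves_cauchy_problem_def algebra_simps)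
  qed
next
  assume u: "u = ?v"
  have G: "((\<lambda>(t, z). u t z) has_derivative
      (\<lambda>h. frechet_derivative p (at (z - (t - t0) *\<^sub>R a)) (snd h - fst h *\<^sub>R a))) (at (t, z))" for t z
    unfolding u case_prod_beta
    by (rule has_derivative_compose[where g = p])
       (auto intro!: derivative_eq_intros simp: frechet_derivative_works[symmetric] assms)
  have "linear (frechet_derivative p (at z))" for z by (simp add: assms linear_frechet_derivative)
  then have "vector_derivative (\<lambda>\<tau>. u \<tau> (x, y)) (at t)
       + vector_derivative (\<lambda>\<xi>. fst (advective_flux a (u t (\<xi>, y)))) (at x)
       + vector_derivative (\<lambda>\<eta>. snd (advective_flux a (u t (x, \<eta>)))) (at y) = 0" for t x y
    unfolding advection_residual[OF G] by (simp add: linear_0)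
  moreover have "(\<lambda>(t, z). u t z) differentiable_on UNIV"
    using G unfolding differentiable_on_def differentiable_def by fast
  ultimately show "solves_cauchy_problem (advective_flux a) t0 p u"
    by (simp add: solves_cauchy_problem_def) (simp add: u)
qed

lemma quad_poly_differentiable: "quad_poly d differentiable (at z)"
  unfolding quad_poly_expand[abs_def] differentiable_def
  by (rule exI) (auto intro!: derivative_eq_intros)

theorem proposition4p1:
  fixes Nx Ny :: nat
    and P :: nodes
    and S :: "cell \<Rightarrow> cell set"
    and R :: "('m :: finite) reconstruction"
    and B :: "'m boundary_state"
    and a\<^sub>x a\<^sub>y t\<^sub>n \<Delta>t :: real
    and c :: "nat \<Rightarrow> nat \<Rightarrow> real ^ 'm"
    and U\<^sub>n U\<^sub>n\<^sub>1 :: "'m averages"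
  assumes mesh: "quad_mesh Nx Ny P"
    and stencil: "stencil_based Nx Ny S R"
    and exact: "two_exact Nx Ny P S R"
    and boundary: "consistent_boundary Nx Ny P B"
    and initial: "\<forall>i \<in> {1..Nx}. \<forall>j \<in> {1..Ny}.
      U\<^sub>n (i, j) = cell_average (region P (i, j)) (quad_poly c)"
    and step: "U\<^sub>n\<^sub>1 = ssprk3_step (fv_operator Nx Ny P R B (advective_flux (a\<^sub>x, a\<^sub>y))) \<Delta>t U\<^sub>n"
  shows "(\<forall>i \<in> {1..Nx}. \<forall>j \<in> {1..Ny}.
      cell_average (region P (i, j)) (quad_poly c) = moment_average (region P (i, j)) c \<and>
      U\<^sub>n\<^sub>1 (i, j) = (1 / moment (region P (i, j)) 0 0) *\<^sub>R
        (\<Sum>s\<le>2. \<Sum>r\<le>2 - s.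
          (\<Sum>k\<le>s. \<Sum>l\<le>r. real (s choose k) * real (r choose l)
             * (- a\<^sub>x * \<Delta>t) ^ (s - k) * (- a\<^sub>y * \<Delta>t) ^ (r - l) * moment (region P (i, j)) k l)
          *\<^sub>R c s r) \<and>
      U\<^sub>n\<^sub>1 (i, j) = cell_average (region P (i, j))
        (\<lambda>(x, y). quad_poly c (x - a\<^sub>x * \<Delta>t, y - a\<^sub>y * \<Delta>t))) \<and>
    (\<forall>u. solves_cauchy_problem (advective_flux (a\<^sub>x, a\<^sub>y)) t\<^sub>n (quad_poly c) u \<longleftrightarrow>
      u = (\<lambda>t (x, y). quad_poly c (x - a\<^sub>x * (t - t\<^sub>n), y - a\<^sub>y * (t - t\<^sub>n))))"
proof -
  let ?a = "(a\<^sub>x, a\<^sub>y)"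
  have cell: "U\<^sub>n c' = moment_average (region P c') c" if "c' \<in> cells Nx Ny" for c'
    using initial that by (auto simp: cells_def cell_average_quad_poly compact_region)
  have main: "U\<^sub>n\<^sub>1 c' = moment_average (region P c') (ssprk3_coeffs ?a \<Delta>t c)"
    if "c' \<in> cells Nx Ny" for c'
    unfolding step
    by (intro ssprk3_step_moment_average[where I = "cells Nx Ny"]
        fv_operator_moment_average[OF mesh stencil exact boundary] cell that)
  \<comment> \<open>The translated polynomial is itself the quadratic with the stepped coefficients,
    so the formula and the exact average both reduce to the same
    \<open>moment_average\<close>.\<close>
  have shifted: "(\<lambda>(x, y). quad_poly c (x - a\<^sub>x * \<Delta>t, y - a\<^sub>y * \<Delta>t)) = quad_poly (ssprk3_coeffs ?a \<Delta>t c)"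
    by (auto simp: quad_poly_ssprk3_coeffs mult.commute)
  have "solves_cauchy_problem (advective_flux ?a) t\<^sub>n (quad_poly c) u \<longleftrightarrow>
      u = (\<lambda>t (x, y). quad_poly c (x - a\<^sub>x * (t - t\<^sub>n), y - a\<^sub>y * (t - t\<^sub>n)))" for u
    unfolding solves_advection_iff[OF quad_poly_differentiable]
    by (auto simp: fun_eq_iff mult.commute)
  moreover have "(i, j) \<in> cells Nx Ny" if "i \<in> {1..Nx}" "j \<in> {1..Ny}" for i j
    using that by (simp add: cells_def)
  ultimately show ?thesis
    using main unfolding shifted cell_average_quad_poly[OF compact_region] moment_average_ssprk3_coeffs
    by blast
qed

end
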